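(* For every constant $0<\delta<1/\mathrm{e}$ there exist a constant $c>0$ and $k_0$ such that for all $k\ge k_0$, when $k$ nodes of a one-hop radio network without collision detection all receive a message at time $0$ and each runs protocol Exp Back-on/Back-off with parameter $\delta$, all $k$ messages are delivered within $4(1+1/\delta)k$ communication steps with probability at least $1-1/k^{c}$.
   Context: Model (one-hop Radio Network without collision detection): time is divided into synchronous communication steps. A node holding an undelivered message is active. In each step each active node may transmit. If exactly one node transmits, its message is delivered and that node becomes idle, never transmitting again. If zero or at least two nodes transmit, nobody receives anything, and nodes cannot distinguish these cases. Nodes know neither $k$ nor the total number of nodes. All $k$ nodes start simultaneously. Protocol Exp Back-on/Back-off with parameter $\delta$: all nodes use the same common sequence of consecutive windows of time steps. For $i=1,2,\dots$ (a phase), set $w\leftarrow2^i$; while $w\ge1$: the next window consists of the next $w$ steps (with $w$ rounded to an integer), each still-active node chooses one step of this window uniformly at random, independently of the others, and transmits in that step only; then $w\leftarrow w(1-\delta)$. *)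

theory Defs
  imports "HOL-Probability.Probability"
begin

definition phase_len :: "real \<Rightarrow> nat \<Rightarrow> nat" where
  "phase_len d i = card {j::nat. 1 \<le> 2 ^ i * (1 - d) ^ j}"

definition phase_ws :: "real \<Rightarrow> nat \<Rightarrow> real list" where
  "phase_ws d i = map (\<lambda>j. 2 ^ i * (1 - d) ^ j) [0..<phase_len d i]"

text \<open>Size (number of steps) of the n-th window (n = 0, 1, ...) of the common
  window sequence; the real value w is rounded to the nearest integer.
  Phases 1..n+1 contain at least n+1 windows, so the index is in range.\<close>

definition win :: "real \<Rightarrow> nat \<Rightarrow> nat" where
  "win d n = nat (round (concat (map (phase_ws d) [1..<n + 2]) ! n))"

definition wstart :: "real \<Rightarrow> nat \<Rightarrow> nat" where
  "wstart d n = (\<Sum>m<n. win d m)"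

text \<open>Random choices: f (n, v) is the slot (0-based offset) of window n in
  which node v transmits if still active.  Nodes are 0..k-1.
  act d k f n = set of nodes still active at the beginning of window n.
  A node is delivered in window n iff it is active and no other active node
  chose the same slot.\<close>

fun act :: "real \<Rightarrow> nat \<Rightarrow> (nat \<times> nat \<Rightarrow> nat) \<Rightarrow> nat \<Rightarrow> nat set" where
  "act d k f 0 = {..<k}"
| "act d k f (Suc n) = act d k f n -
     {v \<in> act d k f n. \<forall>u \<in> act d k f n. u \<noteq> v \<longrightarrow> f (n, u) \<noteq> f (n, v)}"

text \<open>All k messages are delivered within T steps (steps are numbered 1, 2, ...;
  the step of slot s of window n is wstart n + s + 1).\<close>

definition all_delivered_within :: "real \<Rightarrow> nat \<Rightarrow> real \<Rightarrow> (nat \<times> nat \<Rightarrow> nat) \<Rightarrow> bool" where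
  "all_delivered_within d k T f \<longleftrightarrow>
     (\<forall>v<k. \<exists>n. v \<in> act d k f n \<and> v \<notin> act d k f (Suc n) \<and>
                real (wstart d n + f (n, v) + 1) \<le> T)"

text \<open>Distribution of the random choices for windows 0..N-1: independent,
  uniform on the window's slots.  (Windows with index \<ge> N start after step N-1
  since every window has at least one step, so they are irrelevant for a
  deadline T < N.)\<close>

definition choices :: "real \<Rightarrow> nat \<Rightarrow> nat \<Rightarrow> (nat \<times> nat \<Rightarrow> nat) pmf" where
  "choices d k N = Pi_pmf ({..<N} \<times> {..<k}) 0 (\<lambda>(n, v). pmf_of_set {..<win d n})"

definition prob_all_delivered :: "real \<Rightarrow> nat \<Rightarrow> real \<Rightarrow> real" where
  "prob_all_delivered d k T =
     measure_pmf.prob (choices d k (nat \<lceil>T\<rceil> + 1)) {f. all_delivered_within d k T f}"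

end

theory Submission
  imports Defs "HOL-Real_Asymp.Real_Asymp"
begin

text \<open>
  Let \<open>W = 2 ^ i\<close> with \<open>k \<le> W < 2 k\<close>; phase \<open>i\<close> alone delivers everything with high probability.
  While at most \<open>w\<close> nodes are active in a window of size \<open>w\<close>, each is alone with probability at
  least \<open>1/e\<close>, and the number of delivered nodes has variance linear in the number of active ones.
  Chebyshev's inequality therefore shows that the number of active nodes shrinks by a factor
  \<open>\<rho>\<close> with \<open>1 - 1/e < \<rho> < 1 - \<delta>\<close> per window, except with polynomially small probability as long
  as polynomially many nodes remain. Since windows shrink only by \<open>1 - \<delta>\<close>, after a small multiple of
  \<open>ln W\<close> windows the ratio of active nodes to window size is at most \<open>W powr -\<theta>\<close> up to a constant.
  From then on the expected number of active nodes drops by a factor of that order in each window,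
  so constantly many further windows make it \<open>O(1/W)\<close>, and Markov's inequality finishes.
  The real-valued sizes of the windows of phases \<open>1\<close> to \<open>i\<close> sum to less than \<open>2 ^ (i+1) / \<delta> \<le> 4 k / \<delta>\<close>, and
  rounding adds at most the number of windows, which is polylogarithmic in \<open>k\<close>.
\<close>

section \<open>One window\<close>

text \<open>\<open>I\<close> stands for all nodes: as in \<open>choices\<close>, delivered nodes
  draw slots too, and \<open>survivors\<close> ignores their draws.\<close>

definition slots :: "'a set \<Rightarrow> nat \<Rightarrow> ('a \<Rightarrow> nat) pmf" where
  "slots I w = Pi_pmf I 0 (\<lambda>_. pmf_of_set {..<w})"

definition alone :: "'a set \<Rightarrow> ('a \<Rightarrow> nat) \<Rightarrow> 'a \<Rightarrow> bool" where
  "alone A g v \<longleftrightarrow> (\<forall>u\<in>A. u \<noteq> v \<longrightarrow> g u \<noteq> g v)"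

definition survivors :: "'a set \<Rightarrow> ('a \<Rightarrow> nat) \<Rightarrow> 'a set" where
  "survivors A g = A - {v \<in> A. alone A g v}"

section \<open>Probabilities of transmitting alone\<close>

lemma set_slots:
  assumes "finite I" "w > 0"
  shows "set_pmf (slots I w) = PiE_dflt I 0 (\<lambda>_. {..<w})"
  using assms by (auto simp: slots_def set_Pi_pmf set_pmf_of_set lessThan_empty_iff)

lemma finite_set_slots [simp]:
  assumes "finite I" "w > 0"
  shows "finite (set_pmf (slots I w))"
  using assms by (simp add: set_slots finite_PiE_dflt)

text \<open>By independence the event is the box \<open>Pi I B\<close>: a node of \<open>D\<close>
  has one admissible slot, a node of \<open>A - D\<close> avoids the \<open>card D\<close> slots in
  use, and all other nodes are free. It is applied with one and with two nodes in
  \<open>D\<close>.\<close>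

lemma prob_slots_pattern:
  assumes I: "finite I" "A \<subseteq> I" and D: "D \<subseteq> A" and h: "inj_on h D" "h ` D \<subseteq> {..<w}"
    and w: "w > 0"
  shows "measure_pmf.prob (slots I w) {g. (\<forall>x\<in>D. g x = h x) \<and> (\<forall>x\<in>A-D. g x \<notin> h ` D)}
     = (1 / w) ^ card D * (1 - card D / w) ^ (card A - card D)"
proof -
  have fin: "finite A" "finite D" using assms finite_subset by metis+
  define B where "B x = (if x \<in> D then {h x} else if x \<in> A then - (h ` D) else UNIV)" for x
  have cD: "card D \<le> w"
    using card_mono[OF _ h(2)] card_image[OF h(1)] by simp
  have 1: "measure_pmf.prob (pmf_of_set {..<w}) {h x} = 1 / w" if "x \<in> D" for x
    using that h w by (subst measure_pmf_of_set) (auto simp: lessThan_empty_iff)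
  have "{..<w} \<inter> - (h ` D) = {..<w} - h ` D" by auto
  then have "card ({..<w} \<inter> - (h ` D)) = w - card D"
    using h fin by (simp add: card_Diff_subset card_image)
  then have 2: "measure_pmf.prob (pmf_of_set {..<w}) (- (h ` D)) = 1 - card D / w"
    using w cD by (subst measure_pmf_of_set) (auto simp: lessThan_empty_iff of_nat_diff diff_divide_distrib)
  have "{g. (\<forall>x\<in>D. g x = h x) \<and> (\<forall>x\<in>A-D. g x \<notin> h ` D)} = Pi I B"
    using D I unfolding B_def Pi_def by (auto split: if_splits)
  then have "measure_pmf.prob (slots I w) {g. (\<forall>x\<in>D. g x = h x) \<and> (\<forall>x\<in>A-D. g x \<notin> h ` D)}
     = (\<Prod>x\<in>I. measure_pmf.prob (pmf_of_set {..<w}) (B x))"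
    unfolding slots_def using I by (simp add: measure_Pi_pmf_Pi)
  also have "\<dots> = (\<Prod>x\<in>I. if x \<in> D then 1 / w else if x \<in> A then 1 - card D / w else 1)"
    by (intro prod.cong refl) (auto simp: B_def 1 2 measure_pmf.prob_space[simplified])
  also have "\<dots> = (\<Prod>x\<in>D. 1 / w) * (\<Prod>x\<in>A-D. 1 - card D / w)"
  proof -
    have "(\<Prod>x\<in>I. if x \<in> D then 1 / w else if x \<in> A then 1 - card D / w else 1)
      = (\<Prod>x\<in>A. if x \<in> D then 1 / w else 1 - card D / w)"
      using I D by (intro prod.mono_neutral_cong_right) auto
    also have "\<dots> = (\<Prod>x\<in>D. 1 / w) * (\<Prod>x\<in>A-D. 1 - card D / w)"
      using fin D by (subst prod.If_cases) (auto simp: Int_absorb1 Diff_eq intro!: arg_cong2[where f="(*)"])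
    finally show ?thesis .
  qed
  finally show ?thesis using fin D by (simp add: card_Diff_subset)
qed

text \<open>Splitting by the slot \<open>a\<close> of \<open>v\<close> gives \<open>w\<close>
  disjoint, equally likely events.\<close>

lemma prob_alone:
  assumes I: "finite I" "A \<subseteq> I" and v: "v \<in> A" and w: "w > 0"
  shows "measure_pmf.prob (slots I w) {g. alone A g v} = (1 - 1 / w) ^ (card A - 1)"
proof -
  let ?E = "\<lambda>a. {g. (\<forall>x\<in>{v}. g x = a) \<and> (\<forall>x\<in>A-{v}. g x \<notin> (\<lambda>_. a) ` {v})}"
  \<comment> \<open>Off the support \<open>g v\<close> may lie outside the window, so the
    decomposition holds only on the support.\<close>
  have "{g. alone A g v} \<inter> set_pmf (slots I w) = (\<Union>a<w. ?E a) \<inter> set_pmf (slots I w)"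
    using assms by (auto simp: set_slots PiE_dflt_def alone_def)
  then have "measure_pmf.prob (slots I w) {g. alone A g v} = measure_pmf.prob (slots I w) (\<Union>a<w. ?E a)"
    by (subst (1 2) measure_Int_set_pmf[symmetric]) simp
  also have "\<dots> = (\<Sum>a<w. measure_pmf.prob (slots I w) (?E a))"
    by (rule measure_pmf.finite_measure_finite_Union) (auto simp: disjoint_family_on_def)
  also have "\<dots> = (\<Sum>a<w. (1 / w) * (1 - 1 / w) ^ (card A - 1))"
  proof (intro sum.cong refl)
    fix a assume "a \<in> {..<w}"
    then show "measure_pmf.prob (slots I w) (?E a) = (1 / w) * (1 - 1 / w) ^ (card A - 1)"
      using prob_slots_pattern[of I A "{v}" "\<lambda>_. a" w] assms by simp
  qed
  finally show ?thesis using w by simp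
qed

text \<open>A union bound over the \<open>w * w - w\<close> ordered pairs of distinct slots that
  \<open>u\<close> and \<open>v\<close> can occupy.\<close>

lemma prob_alone_pair_le:
  assumes I: "finite I" "A \<subseteq> I" and v: "u \<in> A" "v \<in> A" "u \<noteq> v" and w: "w > 0"
  shows "measure_pmf.prob (slots I w) {g. alone A g u \<and> alone A g v}
     \<le> (1 - 1 / w) * (1 - 2 / w) ^ (card A - 2)"
proof -
  let ?P = "{..<w} \<times> {..<w} - (\<lambda>a. (a, a)) ` {..<w}"
  let ?h = "\<lambda>p::nat\<times>nat. (\<lambda>x. if x = u then fst p else snd p)"
  let ?E = "\<lambda>p. {g. (\<forall>x\<in>{u,v}. g x = ?h p x) \<and> (\<forall>x\<in>A-{u,v}. g x \<notin> ?h p ` {u,v})}"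
  have "{g. alone A g u \<and> alone A g v} \<inter> set_pmf (slots I w) \<subseteq> (\<Union>p\<in>?P. ?E p)"
  proof
    fix g assume "g \<in> {g. alone A g u \<and> alone A g v} \<inter> set_pmf (slots I w)"
    then have "(g u, g v) \<in> ?P" "g \<in> ?E (g u, g v)"
      using assms by (auto simp: set_slots PiE_dflt_def alone_def subset_iff)
    then show "g \<in> (\<Union>p\<in>?P. ?E p)" by blast
  qed
  then have "measure_pmf.prob (slots I w) ({g. alone A g u \<and> alone A g v} \<inter> set_pmf (slots I w))
     \<le> measure_pmf.prob (slots I w) (\<Union>p\<in>?P. ?E p)"
    by (intro measure_pmf.finite_measure_mono) auto
  then have "measure_pmf.prob (slots I w) {g. alone A g u \<and> alone A g v} 
     \<le> measure_pmf.prob (slots I w) (\<Union>p\<in>?P. ?E p)"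
    by (simp only: measure_Int_set_pmf)
  also have "\<dots> \<le> (\<Sum>p\<in>?P. measure_pmf.prob (slots I w) (?E p))"
    by (intro measure_pmf.finite_measure_subadditive_finite) auto
  also have "\<dots> = (\<Sum>p\<in>?P. (1 / w)^2 * (1 - 2 / w) ^ (card A - 2))"
  proof (intro sum.cong refl)
    fix p assume p: "p \<in> ?P"
    then show "measure_pmf.prob (slots I w) (?E p) = (1 / w)^2 * (1 - 2 / w) ^ (card A - 2)"
      using assms by (subst prob_slots_pattern) (auto simp: inj_on_def power2_eq_square numeral_2_eq_2)
  qed
  also have "\<dots> = real (card ?P) * ((1 / w)^2 * (1 - 2 / w) ^ (card A - 2))" by simp
  also have "card ?P = w * w - w"
    by (subst card_Diff_subset) (auto simp: card_image inj_on_def card_cartesian_product)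
  also have "real (w * w - w) = real w * real w - real w"
    by (simp add: of_nat_diff)
  also have "(real w * real w - real w) * ((1 / w)^2 * (1 - 2 / w) ^ (card A - 2))
     = (1 - 1 / w) * (1 - 2 / w) ^ (card A - 2)"
    using w by (simp add: field_simps power2_eq_square)
  finally show ?thesis .
qed

text \<open>Since \<open>1 - 2/w \<le> (1 - 1/w)^2\<close>, the covariance of two singleton indicators is at most \<open>1/w\<close>.\<close>

lemma prob_alone_pair_le_square:
  assumes I: "finite I" "A \<subseteq> I" and v: "u \<in> A" "v \<in> A" "u \<noteq> v" and w: "w > 0"
  shows "measure_pmf.prob (slots I w) {g. alone A g u \<and> alone A g v}
     \<le> ((1 - 1 / w) ^ (card A - 1))^2 + 1 / w"
proof (cases "w = 1")
  case True
  then have "measure_pmf.prob (slots I w) {g. alone A g u \<and> alone A g v} \<le> 0"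
    using prob_alone_pair_le[OF assms] by simp
  also have "0 \<le> ((1 - 1 / w) ^ (card A - 1))^2 + 1 / w" by simp
  finally show ?thesis .
next
  case False
  then have w2: "w \<ge> 2" using w by simp
  define y where "y = 1 - 1 / real w"
  have y: "0 \<le> y" "y \<le> 1" using w by (auto simp: y_def)
  obtain n where n: "card A = n + 2"
  proof -
    have "card {u, v} \<le> card A" using v I finite_subset by (intro card_mono) auto
    then have "card A = (card A - 2) + 2" using v by simp
    then show ?thesis using that by blast
  qed
  have "0 \<le> 1 - 2 / real w" using w2 by simp
  moreover have "1 - 2 / real w \<le> y^2" by (simp add: y_def power2_eq_square algebra_simps)
  ultimately have "y * (1 - 2 / real w) ^ n \<le> y * (y^2) ^ n"
    using y by (intro mult_left_mono power_mono) auto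
  also have "\<dots> \<le> (y ^ (n + 1))^2 + 1 / w"
  proof -
    \<comment> \<open>The pair bound has one factor \<open>y\<close> fewer than the squared
      marginal; this costs at most \<open>1 - y = 1 / w\<close>.\<close>
    have "y * (y^2)^n - (y ^ (n + 1))^2 = y * (y^2)^n * (1 - y)"
      by (simp add: power2_eq_square algebra_simps power_add power_mult_distrib)
    also have "\<dots> \<le> 1 * (1 - y)"
      using y by (intro mult_right_mono mult_le_one power_le_one) auto
    finally show ?thesis by (simp add: y_def)
  qed
  finally show ?thesis using prob_alone_pair_le[OF assms] n by (simp add: y_def)
qed

text \<open>With \<open>n = w - 1\<close> the right side is the reciprocal of
  \<open>(1 + 1 / n) ^ n\<close>, which is at most e.\<close>

lemma inverse_e_le_power:
  assumes "w > 0"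
  shows "1 / exp 1 \<le> (1 - 1 / real w) ^ (w - 1)"
proof (cases "w = 1")
  case False
  define n where "n = w - 1"
  have n: "n > 0" "real w = real n + 1" using assms False by (auto simp: n_def)
  have "(1 + 1 / real n) ^ n \<le> exp (1 / real n) ^ n"
    by (intro power_mono exp_ge_add_one_self) auto
  also have "\<dots> = exp 1" using n by (simp flip: exp_of_nat_mult)
  finally have "1 / exp 1 \<le> 1 / (1 + 1 / real n) ^ n"
    using n by (intro divide_left_mono mult_pos_pos zero_less_power) (auto intro!: add_pos_pos)
  also have "\<dots> = (1 / (1 + 1 / real n)) ^ n" by (simp add: power_one_over)
  also have "1 / (1 + 1 / real n) = 1 - 1 / real w" using n by (simp add: field_simps)
  finally show ?thesis by (simp add: n_def)
qed simp

section \<open>Moments and concentration of the number of lone nodes\<close>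

lemma card_alone_eq_sum:
  assumes "finite A"
  shows "real (card {v \<in> A. alone A g v}) = (\<Sum>v\<in>A. indicator {g. alone A g v} g)"
  using assms by (simp add: indicator_def sum.If_cases Int_def of_bool_def)

lemma card_survivors:
  assumes "finite A"
  shows "real (card (survivors A g)) = real (card A) - real (card {v \<in> A. alone A g v})"
  unfolding survivors_def using assms
  by (subst card_Diff_subset) (auto simp: of_nat_diff card_mono)

lemma survivors_subset: "survivors A g \<subseteq> A"
  by (auto simp: survivors_def)

lemma integrable_slots [simp]:
  fixes h :: "('a \<Rightarrow> nat) \<Rightarrow> real"
  assumes "finite I" "w > 0"
  shows "integrable (measure_pmf (slots I w)) h"
  using assms by (intro integrable_measure_pmf_finite) simp

lemma expectation_card_alone:
  assumes "finite I" "A \<subseteq> I" "w > 0"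
  shows "measure_pmf.expectation (slots I w) (\<lambda>g. card {v \<in> A. alone A g v})
     = card A * (1 - 1 / w) ^ (card A - 1)"
proof -
  have "finite A" using assms finite_subset by blast
  then show ?thesis
    using assms by (simp add: card_alone_eq_sum Bochner_Integration.integral_sum prob_alone)
qed

text \<open>Bernoulli's inequality bounds the collision probability of one node by
  \<open>card A / w\<close>. This survival factor becomes small with the load, which drives the
  second stage.\<close>

lemma expectation_card_survivors_le:
  assumes "finite I" "A \<subseteq> I" "w > 0"
  shows "measure_pmf.expectation (slots I w) (\<lambda>g. card (survivors A g)) \<le> card A * (card A / w)"
proof -
  have fin: "finite A" using assms finite_subset by blast
  have "1 - card A / w \<le> 1 + real (card A - 1) * (- 1 / w)"
    by (simp add: divide_right_mono)
  also have "\<dots> \<le> (1 + (- 1 / w)) ^ (card A - 1)"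
    using assms by (intro Bernoulli_inequality) simp
  finally have "1 - (1 - 1 / w) ^ (card A - 1) \<le> card A / w" by simp
  then have "card A * (1 - (1 - 1 / w) ^ (card A - 1)) \<le> card A * (card A / w)"
    by (intro mult_left_mono) auto
  then show ?thesis
    using assms fin by (simp add: card_survivors expectation_card_alone algebra_simps)
qed

text \<open>Expanding the square into pairs, the diagonal adds at most \<open>card A\<close>, and
  the covariance terms at most \<open>card A * card A / w \<le> card A\<close>. Hence the variance
  is at most \<open>2 * card A\<close>.\<close>

lemma expectation_card_alone_sq_le:
  assumes I: "finite I" "A \<subseteq> I" and w: "w > 0" and le: "card A \<le> w"
  shows "measure_pmf.expectation (slots I w) (\<lambda>g. (real (card {v \<in> A. alone A g v}))^2)
     \<le> 2 * card A + (card A * (1 - 1 / w) ^ (card A - 1))^2"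
proof -
  define p where "p = (1 - 1 / w) ^ (card A - 1)"
  define m where "m = card A"
  have p: "0 \<le> p" "p \<le> 1" unfolding p_def using w by (auto intro!: power_le_one)
  have fin: "finite A" using assms finite_subset by blast
  have "measure_pmf.expectation (slots I w) (\<lambda>g. (real (card {v \<in> A. alone A g v}))^2)
     = measure_pmf.expectation (slots I w) (\<lambda>g. \<Sum>u\<in>A. \<Sum>v\<in>A. indicator {g. alone A g u \<and> alone A g v} g)"
    unfolding card_alone_eq_sum[OF fin] power2_eq_square sum_product
    by (intro Bochner_Integration.integral_cong sum.cong refl) (auto simp: indicator_def)
  also have "\<dots> = (\<Sum>u\<in>A. \<Sum>v\<in>A. measure_pmf.prob (slots I w) {g. alone A g u \<and> alone A g v})"
    using I w by (simp add: Bochner_Integration.integral_sum)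
  also have "\<dots> \<le> (\<Sum>u\<in>A. \<Sum>v\<in>A. (if u = v then 1 else 0) + (p^2 + 1 / w))"
  proof (intro sum_mono)
    fix u v assume "u \<in> A" "v \<in> A"
    then show "measure_pmf.prob (slots I w) {g. alone A g u \<and> alone A g v}
       \<le> (if u = v then 1 else 0) + (p^2 + 1 / w)"
      using prob_alone_pair_le_square[OF I, of u v w] w
        measure_pmf.prob_le_1[of "slots I w" "{g. alone A g u \<and> alone A g v}"]
      by (auto simp: p_def intro: order_trans)
  qed
  also have "\<dots> = m + m * m * (p^2 + 1 / w)"
    using fin by (simp add: sum.distrib m_def algebra_simps)
  also have "\<dots> \<le> m + (m * m * p^2 + m)"
  proof -
    have "real m * (real m / real w) \<le> real m * 1"
      using le w by (intro mult_left_mono) (auto simp: m_def)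
    then show ?thesis by (simp add: algebra_simps)
  qed
  finally show ?thesis by (simp add: p_def m_def power2_eq_square mult_ac)
qed

text \<open>Chebyshev's inequality: since \<open>card A \<le> w\<close>, the mean number of lone
  nodes is at least \<open>card A / exp 1\<close>, so the event forces a deviation of
  \<open>\<epsilon> * card A\<close>. The bound is useful only while many nodes are active.\<close>

lemma prob_many_survivors:
  fixes \<epsilon> :: real
  assumes I: "finite I" "A \<subseteq> I" and w: "w > 0" and le: "card A \<le> w" and pos: "card A > 0"
    and \<epsilon>: "\<epsilon> > 0"
  shows "measure_pmf.prob (slots I w) {g. real (card (survivors A g)) > (1 - 1 / exp 1 + \<epsilon>) * card A}
     \<le> 2 / (\<epsilon>^2 * card A)"
proof -
  let ?D = "\<lambda>g. real (card {v \<in> A. alone A g v})"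
  let ?\<mu> = "measure_pmf.expectation (slots I w) ?D"
  define p where "p = (1 - 1 / w) ^ (card A - 1)"
  have fin: "finite A" using assms finite_subset by blast
  have \<mu>: "?\<mu> = card A * p" unfolding p_def using I w by (rule expectation_card_alone)
  have "1 / exp 1 \<le> (1 - 1 / real w) ^ (w - 1)" using w by (rule inverse_e_le_power)
  also have "\<dots> \<le> p" unfolding p_def using le w by (intro power_decreasing) auto
  finally have p: "1 / exp 1 \<le> p" .
  have "measure_pmf.variance (slots I w) ?D
      = measure_pmf.expectation (slots I w) (\<lambda>g. (?D g)^2) - ?\<mu>^2"
    using I w by (subst measure_pmf.variance_eq) auto
  also have "\<dots> \<le> 2 * card A"
    using expectation_card_alone_sq_le[OF I w le] by (simp add: \<mu> p_def)
  finally have var: "measure_pmf.variance (slots I w) ?D \<le> 2 * card A" .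
  have "measure_pmf.prob (slots I w) {g. real (card (survivors A g)) > (1 - 1 / exp 1 + \<epsilon>) * card A}
     \<le> measure_pmf.prob (slots I w) {g \<in> space (slots I w). \<bar>?D g - ?\<mu>\<bar> \<ge> \<epsilon> * card A}"
  proof (intro measure_pmf.finite_measure_mono subsetI)
    fix g assume "g \<in> {g. real (card (survivors A g)) > (1 - 1 / exp 1 + \<epsilon>) * card A}"
    then have "?D g < (1 / exp 1 - \<epsilon>) * card A"
      using fin by (simp add: card_survivors algebra_simps)
    also have "\<dots> \<le> (p - \<epsilon>) * card A" using p by (intro mult_right_mono) auto
    finally show "g \<in> {g \<in> space (slots I w). \<bar>?D g - ?\<mu>\<bar> \<ge> \<epsilon> * card A}"
      by (simp add: \<mu> algebra_simps)
  qed simp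
  also have "\<dots> \<le> measure_pmf.variance (slots I w) ?D / (\<epsilon> * card A)^2"
    using I w \<epsilon> pos by (intro measure_pmf.Chebyshev_inequality) auto
  also have "\<dots> \<le> 2 * card A / (\<epsilon> * card A)^2"
    using var by (intro divide_right_mono) auto
  also have "\<dots> = 2 / (\<epsilon>^2 * card A)" using pos by (simp add: power2_eq_square)
  finally show ?thesis .
qed

section \<open>The Markov chain of active nodes\<close>

definition round_step :: "'a set \<Rightarrow> nat \<Rightarrow> 'a set \<Rightarrow> 'a set pmf" where
  "round_step I w A = map_pmf (survivors A) (slots I w)"

primrec remaining :: "'a set \<Rightarrow> (nat \<Rightarrow> nat) \<Rightarrow> nat \<Rightarrow> 'a set \<Rightarrow> 'a set pmf" where
  "remaining I ws 0 A = return_pmf A"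
| "remaining I ws (Suc n) A = bind_pmf (remaining I ws n A) (round_step I (ws n))"

text \<open>The Markov property at time \<open>n\<close>; it separates the two stages of a phase,
  and a phase from its predecessors.\<close>

lemma remaining_add:
  "remaining I ws (n + l) A = bind_pmf (remaining I ws n A) (remaining I (\<lambda>i. ws (n + i)) l)"
  by (induction l) (auto simp: bind_return_pmf' bind_assoc_pmf)

lemma set_remaining: "S \<in> set_pmf (remaining I ws n A) \<Longrightarrow> S \<subseteq> A"
proof (induction n arbitrary: S)
  case (Suc n)
  then show ?case using survivors_subset by (force simp: round_step_def)
qed simp

text \<open>Active sets only shrink, so the initial size of \<open>A\<close> controls the load of
  every window, and each window multiplies the expectation by at most
  \<open>\<beta>\<close>.\<close>

lemma expectation_card_remaining_le:
  fixes \<beta> :: real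
  assumes I: "finite I" "A \<subseteq> I" and ws: "\<And>i. i < l \<Longrightarrow> ws i > 0"
    and \<beta>: "\<And>i. i < l \<Longrightarrow> card A \<le> \<beta> * ws i" "\<beta> \<ge> 0"
  shows "measure_pmf.expectation (remaining I ws l A) (\<lambda>S. real (card S)) \<le> \<beta> ^ l * card A"
  using ws \<beta>
proof (induction l)
  case (Suc l)
  have fin: "finite A" using I finite_subset by blast
  let ?R = "remaining I ws l A"
  have sub: "set_pmf ?R \<subseteq> Pow A" using set_remaining by blast
  have "measure_pmf.expectation (remaining I ws (Suc l) A) (\<lambda>S. real (card S))
     = (\<Sum>S\<in>Pow A. pmf ?R S *\<^sub>R measure_pmf.expectation (round_step I (ws l) S) (\<lambda>S. real (card S)))"
    unfolding remaining.simps
    by (rule pmf_expectation_bind[OF _ _ sub]) (use fin I Suc.prems in \<open>auto simp: round_step_def\<close>)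
  also have "\<dots> \<le> (\<Sum>S\<in>Pow A. pmf ?R S *\<^sub>R (\<beta> * card S))"
  proof (intro sum_mono scaleR_left_mono)
    fix S assume S: "S \<in> Pow A"
    then have SA: "card S \<le> card A" using fin card_mono by auto
    have "measure_pmf.expectation (round_step I (ws l) S) (\<lambda>S. real (card S))
      \<le> card S * (card S / ws l)"
      using expectation_card_survivors_le[of I S "ws l"] S I Suc.prems by (simp add: round_step_def)
    also have "\<dots> \<le> card S * \<beta>"
    proof (intro mult_left_mono)
      have "real (card S) \<le> \<beta> * ws l" using SA Suc.prems(2)[of l] by linarith
      then show "card S / ws l \<le> \<beta>" using Suc.prems(1)[of l] by (simp add: divide_le_eq)
    qed simp
    finally show "measure_pmf.expectation (round_step I (ws l) S) (\<lambda>S. real (card S)) \<le> \<beta> * card S"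
      by (simp add: mult.commute)
  qed simp
  also have "\<dots> = \<beta> * (\<Sum>S\<in>Pow A. pmf ?R S *\<^sub>R card S)"
    by (simp add: sum_distrib_left mult_ac)
  also have "(\<Sum>S\<in>Pow A. pmf ?R S *\<^sub>R card S) = measure_pmf.expectation ?R (\<lambda>S. real (card S))"
    using fin sub by (subst integral_measure_pmf[of "Pow A"]) auto
  also have "\<beta> * measure_pmf.expectation ?R (\<lambda>S. real (card S)) \<le> \<beta> * (\<beta> ^ l * card A)"
    using Suc.prems by (intro mult_left_mono Suc.IH) auto
  finally show ?case by (simp add: mult_ac)
qed simp

text \<open>Markov's inequality: a nonempty finite set has cardinality at least 1.\<close>

lemma prob_remaining_nonempty_le:
  fixes \<beta> :: real
  assumes I: "finite I" "A \<subseteq> I" and ws: "\<And>i. i < l \<Longrightarrow> ws i > 0"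
    and \<beta>: "\<And>i. i < l \<Longrightarrow> card A \<le> \<beta> * ws i" "\<beta> \<ge> 0"
  shows "measure_pmf.prob (remaining I ws l A) {S. S \<noteq> {}} \<le> \<beta> ^ l * card A"
proof -
  have fin: "finite A" using I finite_subset by blast
  let ?R = "remaining I ws l A"
  have sub: "set_pmf ?R \<subseteq> Pow A" using set_remaining by blast
  then have finR: "finite (set_pmf ?R)" using fin finite_subset by blast
  have "measure_pmf.prob ?R {S. S \<noteq> {}} = measure_pmf.expectation ?R (indicator {S. S \<noteq> {}})" by simp
  also have "\<dots> \<le> measure_pmf.expectation ?R (\<lambda>S. real (card S))"
  proof (intro integral_mono_AE integrable_measure_pmf_finite finR)
    show "AE S in ?R. indicator {S. S \<noteq> {}} S \<le> real (card S)"
    proof (rule AE_pmfI)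
      fix S assume "S \<in> set_pmf ?R"
      then have "finite S" using sub fin finite_subset by blast
      then show "indicator {S. S \<noteq> {}} S \<le> real (card S)"
        by (auto simp: indicator_def Suc_le_eq card_gt_0_iff)
    qed
  qed
  also have "\<dots> \<le> \<beta> ^ l * card A" by (rule expectation_card_remaining_le[OF I ws \<beta>])
  finally show ?thesis .
qed

text \<open>A union bound for two consecutive experiments: \<open>B\<close> collects the bad
  intermediate outcomes, and \<open>c\<close> bounds the failure after a good one.\<close>

lemma prob_bind_pmf_le:
  assumes "\<And>x. x \<in> set_pmf p \<Longrightarrow> x \<notin> B \<Longrightarrow> measure_pmf.prob (f x) E \<le> c" "c \<ge> 0"
  shows "measure_pmf.prob (bind_pmf p f) E \<le> measure_pmf.prob p B + c"
proof -
  have "emeasure (bind_pmf p f) E = (\<integral>\<^sup>+x. emeasure (f x) E \<partial>p)" by simp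
  also have "\<dots> \<le> (\<integral>\<^sup>+x. indicator B x + ennreal c \<partial>p)"
  proof (intro nn_integral_mono_AE AE_pmfI)
    fix x assume x: "x \<in> set_pmf p"
    show "emeasure (f x) E \<le> indicator B x + ennreal c"
    proof (cases "x \<in> B")
      case True
      then show ?thesis using measure_pmf.emeasure_le_1[of "f x" E] by (simp add: add_increasing2)
    next
      case False
      then show ?thesis using assms(1)[OF x False] by (simp add: measure_pmf.emeasure_eq_measure ennreal_leI)
    qed
  qed
  also have "\<dots> = ennreal (measure_pmf.prob p B + c)"
    using assms(2) by (subst nn_integral_add) (auto simp: measure_pmf.emeasure_eq_measure)
  finally show ?thesis
    using assms(2) by (simp add: measure_pmf.emeasure_eq_measure del: ennreal_plus)
qed

text \<open>A union bound over the windows for the targets \<open>\<rho> ^ t * W\<close>. Every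
  target up to time \<open>T\<close> is at least \<open>s\<close>, which makes the Chebyshev error
  uniform. The condition \<open>fit\<close> speaks of natural numbers so that it survives rounding
  of the window sizes.\<close>

lemma prob_card_remaining_gt_le:
  fixes \<epsilon> W s :: real
  defines "\<rho> \<equiv> 1 - 1 / exp 1 + \<epsilon>"
  assumes I: "finite I" "A \<subseteq> I" "card A \<le> W" and ws: "\<And>i. i < T \<Longrightarrow> ws i > 0"
    and fit: "\<And>i m::nat. i < T \<Longrightarrow> m \<le> \<rho> ^ i * W \<Longrightarrow> m \<le> ws i"
    and \<epsilon>: "\<epsilon> > 0" and \<rho>: "\<rho> \<le> 1" and s: "0 < s" "s \<le> \<rho> ^ T * W"
    and t: "t \<le> T"
  shows "measure_pmf.prob (remaining I ws t A) {S. card S > \<rho> ^ t * W} \<le> t * (2 / (\<epsilon>^2 * s))"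
  using t
proof (induction t)
  case 0
  then show ?case using I by simp
next
  case (Suc t)
  have \<rho>0: "\<rho> > 0" unfolding \<rho>_def using \<epsilon> by (simp add: add_nonneg_pos)
  have W: "W \<ge> 0" using I by linarith
  have "measure_pmf.prob (remaining I ws (Suc t) A) {S. card S > \<rho> ^ Suc t * W}
    \<le> measure_pmf.prob (remaining I ws t A) {S. card S > \<rho> ^ t * W} + 2 / (\<epsilon>^2 * s)"
    unfolding remaining.simps
  proof (intro prob_bind_pmf_le)
    fix S assume S: "S \<in> set_pmf (remaining I ws t A)" "S \<notin> {S. card S > \<rho> ^ t * W}"
    then have SA: "S \<subseteq> A" using set_remaining by blast
    then have SI: "S \<subseteq> I" using I by blast
    have finS: "finite S" by (rule finite_subset[OF SI I(1)])
    have step: "measure_pmf.prob (round_step I (ws t) S) {S. card S > \<rho> ^ Suc t * W}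
       = measure_pmf.prob (slots I (ws t)) {g. card (survivors S g) > \<rho> ^ Suc t * W}"
      by (simp add: round_step_def)
    show "measure_pmf.prob (round_step I (ws t) S) {S. card S > \<rho> ^ Suc t * W} \<le> 2 / (\<epsilon>^2 * s)"
    \<comment> \<open>Either \<open>S\<close> already meets the next target and cannot miss it, or
      it has more than \<open>s\<close> elements or exactly so many that Chebyshev's bound with
      \<open>s\<close> applies.\<close>
    proof (cases "card S \<le> \<rho> ^ Suc t * W")
      case True
      have "\<not> card (survivors S g) > \<rho> ^ Suc t * W" for g
      proof -
        have "card (survivors S g) \<le> card S" using finS survivors_subset by (rule card_mono)
        then show ?thesis using True by linarith
      qed
      then have "{g. card (survivors S g) > \<rho> ^ Suc t * W} = {}" by blast
      then show ?thesis unfolding step using s by simp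
    next
      case False
      have "s \<le> \<rho> ^ T * W" by (rule s)
      also have "\<dots> \<le> \<rho> ^ Suc t * W"
        using Suc.prems W \<rho> \<rho>0 by (intro mult_right_mono power_decreasing) auto
      also have "\<dots> \<le> card S" using False by simp
      finally have sS: "s \<le> card S" .
      have "measure_pmf.prob (slots I (ws t)) {g. card (survivors S g) > \<rho> ^ Suc t * W}
        \<le> measure_pmf.prob (slots I (ws t)) {g. real (card (survivors S g)) > \<rho> * card S}"
      proof (intro measure_pmf.finite_measure_mono subsetI)
        fix g assume g: "g \<in> {g. card (survivors S g) > \<rho> ^ Suc t * W}"
        have "\<rho> * card S \<le> \<rho> * (\<rho> ^ t * W)" using S \<rho>0 by (intro mult_left_mono) auto
        then show "g \<in> {g. real (card (survivors S g)) > \<rho> * card S}" using g by simp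
      qed simp
      also have "\<dots> \<le> 2 / (\<epsilon>^2 * card S)"
        unfolding \<rho>_def using S I SI \<epsilon> s sS fit[of t "card S"] ws[of t] Suc.prems
        by (intro prob_many_survivors) auto
      also have "\<dots> \<le> 2 / (\<epsilon>^2 * s)"
        using s sS \<epsilon> by (intro divide_left_mono mult_left_mono mult_pos_pos) auto
      finally show ?thesis unfolding step .
    qed
  qed (use s in auto)
  also have "\<dots> \<le> t * (2 / (\<epsilon>^2 * s)) + 2 / (\<epsilon>^2 * s)" using Suc by simp
  finally show ?case by (simp add: algebra_simps add_divide_distrib)
qed

text \<open>Chebyshev's inequality controls the first \<open>T\<close> windows; conditioned on
  reaching the target, Markov's inequality controls the next \<open>L\<close>.\<close>

lemma prob_remaining_nonempty_two_stage_le: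
  fixes \<epsilon> W s \<beta> :: real
  defines "\<rho> \<equiv> 1 - 1 / exp 1 + \<epsilon>"
  assumes I: "finite I" "A \<subseteq> I" "card A \<le> W" and ws: "\<And>i. i < T + L \<Longrightarrow> ws i > 0"
    and fit: "\<And>i m::nat. i < T \<Longrightarrow> m \<le> \<rho> ^ i * W \<Longrightarrow> m \<le> ws i"
    and \<epsilon>: "\<epsilon> > 0" and \<rho>: "\<rho> \<le> 1" and s: "0 < s" "s \<le> \<rho> ^ T * W"
    and \<beta>: "\<And>i. i < L \<Longrightarrow> \<rho> ^ T * W \<le> \<beta> * ws (T + i)" "\<beta> \<ge> 0"
  shows "measure_pmf.prob (remaining I ws (T + L) A) {S. S \<noteq> {}}
     \<le> T * (2 / (\<epsilon>^2 * s)) + \<beta> ^ L * W"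
proof -
  have \<rho>0: "\<rho> > 0" unfolding \<rho>_def using \<epsilon> by (simp add: add_nonneg_pos)
  have W: "W \<ge> 0" using I by linarith
  have "measure_pmf.prob (remaining I ws (T + L) A) {S. S \<noteq> {}}
    \<le> measure_pmf.prob (remaining I ws T A) {S. card S > \<rho> ^ T * W} + \<beta> ^ L * W"
    unfolding remaining_add
  proof (rule prob_bind_pmf_le)
    fix S assume S: "S \<in> set_pmf (remaining I ws T A)" "S \<notin> {S. card S > \<rho> ^ T * W}"
    then have SA: "S \<subseteq> A" using set_remaining by blast
    then have SI: "S \<subseteq> I" using I by blast
    have "measure_pmf.prob (remaining I (\<lambda>i. ws (T + i)) L S) {S. S \<noteq> {}} \<le> \<beta> ^ L * card S"
    proof (rule prob_remaining_nonempty_le[OF I(1) SI])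
      show "card S \<le> \<beta> * ws (T + i)" if "i < L" for i using \<beta>(1)[OF that] S by auto
    qed (use ws \<beta> in auto)
    \<comment> \<open>The crude bound \<open>card S \<le> W\<close> suffices for the last
      factor.\<close>
    also have "\<dots> \<le> \<beta> ^ L * W"
    proof (intro mult_left_mono)
      have "card S \<le> card A" by (rule card_mono[OF finite_subset[OF I(2,1)] SA])
      then show "card S \<le> W" using I by linarith
    qed (use \<beta> in auto)
    finally show "measure_pmf.prob (remaining I (\<lambda>i. ws (T + i)) L S) {S. S \<noteq> {}} \<le> \<beta> ^ L * W" .
  qed (use \<beta> W in auto)
  also have "measure_pmf.prob (remaining I ws T A) {S. card S > \<rho> ^ T * W} \<le> T * (2 / (\<epsilon>^2 * s))"
    unfolding \<rho>_def by (rule prob_card_remaining_gt_le) (use assms in auto)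
  finally show ?thesis by simp
qed

section \<open>The active sets of the protocol follow the Markov chain\<close>

lemma act_subset: "act d k f n \<subseteq> {..<k}"
  by (induction n) auto

lemma act_Suc_eq: "act d k f (Suc n) = survivors (act d k f n) (\<lambda>v. f (n, v))"
  by (auto simp: survivors_def alone_def)

lemma act_cong:
  assumes "\<And>m v. m < n \<Longrightarrow> v < k \<Longrightarrow> f (m, v) = g (m, v)"
  shows "act d k f n = act d k g n"
  using assms
proof (induction n)
  case (Suc n)
  then have "act d k f n = act d k g n" by simp
  moreover have "\<forall>v \<in> act d k g n. f (n, v) = g (n, v)"
    using Suc.prems act_subset[of d k g n] by auto
  ultimately show ?case by (auto simp: act_Suc_eq survivors_def alone_def simp del: act.simps)
qed simp

lemma map_act_choices_restrict:
  assumes "n \<le> N"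
  shows "map_pmf (\<lambda>f. act d k f n) (choices d k N) = map_pmf (\<lambda>f. act d k f n) (choices d k n)"
proof -
  have "choices d k n
     = map_pmf (\<lambda>f x. if x \<in> {..<n} \<times> {..<k} then f x else 0) (choices d k N)"
    unfolding choices_def by (rule Pi_pmf_subset) (use assms in auto)
  then show ?thesis
    by (simp add: map_pmf_comp) (intro map_pmf_cong refl act_cong, auto)
qed

text \<open>The active set before window \<open>n\<close> depends only on earlier choices, and these
  are independent of the choices in window \<open>n\<close>; hence its law evolves by
  \<open>round_step\<close>.\<close>

lemma map_act_choices:
  assumes "n \<le> N"
  shows "map_pmf (\<lambda>f. act d k f n) (choices d k N) = remaining {..<k} (win d) n {..<k}"
proof -
  have "map_pmf (\<lambda>f. act d k f n) (choices d k n) = remaining {..<k} (win d) n {..<k}"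
  proof (induction n)
    case (Suc n)
    let ?q = "\<lambda>(n, v). pmf_of_set {..<win d n}"
    let ?S = "Pi_pmf ({n} \<times> {..<k}) 0 ?q"
    \<comment> \<open>Reindexing from pairs \<open>(n, v)\<close> to nodes \<open>v\<close> turns
      the choices of window \<open>n\<close> into \<open>slots\<close>.\<close>
    have slots: "slots {..<k} (win d n) = map_pmf (\<lambda>g v. g (n, v)) ?S"
    proof -
      have "slots {..<k} (win d n)
         = map_pmf (\<lambda>g. g \<circ> Pair n) (Pi_pmf ({n} \<times> {..<k}) 0 (\<lambda>_. pmf_of_set {..<win d n}))"
        unfolding slots_def by (rule Pi_pmf_bij_betw) (auto simp: bij_betw_def inj_on_def)
      also have "Pi_pmf ({n} \<times> {..<k}) 0 (\<lambda>_. pmf_of_set {..<win d n}) = ?S"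
        by (intro Pi_pmf_cong) auto
      finally show ?thesis by (simp add: comp_def)
    qed
    have "{..<Suc n} \<times> {..<k} = {..<n} \<times> {..<k} \<union> {n} \<times> {..<k}" by auto
    then have "choices d k (Suc n) = map_pmf (\<lambda>(f, g) x. if x \<in> {..<n} \<times> {..<k} then f x else g x)
        (pair_pmf (choices d k n) ?S)"
      unfolding choices_def by (simp only:) (rule Pi_pmf_union, auto)
    then have "map_pmf (\<lambda>f. act d k f (Suc n)) (choices d k (Suc n))
       = map_pmf (\<lambda>(f, g). survivors (act d k f n) (\<lambda>v. g (n, v))) (pair_pmf (choices d k n) ?S)"
      by (simp add: map_pmf_comp case_prod_unfold act_Suc_eq del: act.simps)
         (intro map_pmf_cong refl arg_cong2[where f=survivors] act_cong, auto)
    also have "\<dots> = bind_pmf (map_pmf (\<lambda>f. act d k f n) (choices d k n)) (round_step {..<k} (win d n))"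
      by (simp add: round_step_def[abs_def] slots pair_pmf_def map_pmf_def bind_assoc_pmf bind_return_pmf)
    finally show ?case using Suc by simp
  qed (simp add: map_pmf_const)
  then show ?thesis using map_act_choices_restrict[OF assms] by metis
qed

section \<open>Windows and deadlines\<close>

text \<open>Windows are numbered from 0 and phases from 1, so this is the index of the first window
  of phase \<open>i\<close>.\<close>

definition phase_start :: "real \<Rightarrow> nat \<Rightarrow> nat" where
  "phase_start d i = (\<Sum>m\<in>{1..<i}. phase_len d m)"

text \<open>The set counted by \<open>phase_len\<close> is finite and closed downwards, hence an
  initial segment of the naturals.\<close>

lemma less_phase_len_iff:
  fixes d :: real
  assumes d: "0 < d" "d < 1"
  shows "j < phase_len d i \<longleftrightarrow> 1 \<le> 2 ^ i * (1 - d) ^ j"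
proof -
  let ?S = "{j::nat. 1 \<le> 2 ^ i * (1 - d) ^ j}"
  have down: "j' \<in> ?S" if "j \<in> ?S" "j' \<le> j" for j j'
  proof -
    have "(1 - d) ^ j \<le> (1 - d) ^ j'" using that d by (intro power_decreasing) auto
    then have "2 ^ i * (1 - d) ^ j \<le> 2 ^ i * (1 - d) ^ j'" by (intro mult_left_mono) auto
    moreover have "1 \<le> 2 ^ i * (1 - d) ^ j" using that by simp
    ultimately have "1 \<le> 2 ^ i * (1 - d) ^ j'" by linarith
    then show ?thesis by simp
  qed
  obtain n where n: "(1 - d) ^ n < 1 / 2 ^ i"
    using real_arch_pow_inv[of "1 / 2 ^ i" "1 - d"] d by auto
  then have "n \<notin> ?S" by (simp add: field_simps)
  then have "?S \<subseteq> {..<n}" using down by (metis lessThan_iff linorder_not_le subsetI)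
  then have fin: "finite ?S" using finite_subset by blast
  have 0: "0 \<in> ?S" by simp
  have "?S = {..Max ?S}"
    using down[OF Max_in[OF fin]] 0 Max_ge[OF fin] by blast
  then have "card ?S = Suc (Max ?S)" by (metis card_atMost)
  then have "?S = {..<card ?S}" using \<open>?S = {..Max ?S}\<close> by (simp add: lessThan_Suc_atMost)
  then show ?thesis unfolding phase_len_def by blast
qed

lemma phase_len_pos:
  assumes "0 < d" "d < 1"
  shows "phase_len d i > 0"
  using assms by (subst less_phase_len_iff) auto

text \<open>The last window satisfies
  \<open>1 \<le> 2 ^ i * (1 - d) ^ j \<le> exp (i - d * j)\<close>, using
  \<open>2 \<le> exp 1\<close> and \<open>1 - d \<le> exp (- d)\<close>.\<close>

lemma phase_len_le:
  assumes d: "0 < d" "d < 1"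
  shows "phase_len d i \<le> i / d + 1"
proof -
  define j where "j = phase_len d i - 1"
  have j: "phase_len d i = Suc j" using phase_len_pos[OF d, of i] by (simp add: j_def)
  then have "1 \<le> 2 ^ i * (1 - d) ^ j" using less_phase_len_iff[OF d, of j i] by simp
  also have "\<dots> \<le> exp 1 ^ i * exp (- d) ^ j"
    using d exp_ge_add_one_self[of "1::real"] exp_ge_add_one_self[of "-d"]
    by (intro mult_mono power_mono) auto
  also have "\<dots> = exp (i - d * j)"
    by (simp add: exp_diff exp_minus exp_of_nat_mult[symmetric] mult_ac field_simps)
  finally have "d * j \<le> i" by simp
  then show ?thesis using d j by (simp add: field_simps)
qed

lemma phase_start_Suc: "1 \<le> i \<Longrightarrow> phase_start d (Suc i) = phase_start d i + phase_len d i"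
  by (simp add: phase_start_def)

lemma length_phases: "length (concat (map (phase_ws d) [1..<i])) = phase_start d i"
  by (simp add: length_concat phase_start_def phase_ws_def comp_def interv_sum_list_conv_sum_set_nat)

lemma phase_start_ge:
  assumes "0 < d" "d < 1"
  shows "i - 1 \<le> phase_start d i"
proof -
  have "(\<Sum>m\<in>{1..<i}. 1) \<le> phase_start d i"
    unfolding phase_start_def using phase_len_pos[OF assms] by (intro sum_mono) (simp add: Suc_le_eq)
  then show ?thesis by simp
qed

lemma win_phase:
  fixes d :: real
  assumes d: "0 < d" "d < 1" and i: "1 \<le> i" and j: "j < phase_len d i"
  shows "win d (phase_start d i + j) = nat (round (2 ^ i * (1 - d) ^ j))"
proof -
  define n where "n = phase_start d i + j"
  \<comment> \<open>Every earlier phase has a window, so phase \<open>i\<close> is among the phases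
    \<open>1\<close> to \<open>n + 1\<close> listed in \<open>win d n\<close>.\<close>
  have "i < n + 2" using phase_start_ge[OF d, of i] i by (simp add: n_def)
  then have "[1..<n + 2] = [1..<i] @ i # [Suc i..<n + 2]"
    using i upt_add_eq_append[of 1 i "n + 2 - i"] upt_conv_Cons[of i "n + 2"] by simp
  then have "concat (map (phase_ws d) [1..<n + 2])
     = concat (map (phase_ws d) [1..<i]) @ phase_ws d i @ concat (map (phase_ws d) [Suc i..<n + 2])"
    by simp
  then have "concat (map (phase_ws d) [1..<n + 2]) ! n = phase_ws d i ! j"
    using j by (simp add: n_def nth_append length_phases[simplified]) (simp add: phase_ws_def)
  then show ?thesis using j by (simp add: win_def n_def phase_ws_def)
qed

lemma win_pos:
  assumes d: "0 < d" "d < 1"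
  shows "win d n > 0"
proof -
  let ?xs = "concat (map (phase_ws d) [1..<n + 2])"
  have "n < length ?xs" using phase_start_ge[OF d, of "n + 2"] unfolding length_phases by simp
  then have "?xs ! n \<in> set ?xs" by (rule nth_mem)
  then obtain i j where "j < phase_len d i" "?xs ! n = 2 ^ i * (1 - d) ^ j"
    by (auto simp: phase_ws_def)
  then have "1 \<le> ?xs ! n" using less_phase_len_iff[OF d] by simp
  from round_mono[OF this] show ?thesis by (simp add: win_def)
qed

lemma win_le:
  fixes d :: real
  assumes d: "0 < d" "d < 1" and i: "1 \<le> i" and j: "j < phase_len d i"
  shows "win d (phase_start d i + j) \<le> 2 ^ i * (1 - d) ^ j + 1"
proof -
  let ?x = "2 ^ i * (1 - d) ^ j"
  have "0 \<le> ?x" using d by simp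
  then have "real_of_int (round ?x) \<ge> 0"
    using round_mono[of 0 ?x] by simp
  then show ?thesis
    using of_int_round_le[of ?x] by (simp add: win_phase[OF assms])
qed

section \<open>Start times of windows\<close>

lemma wstart_add: "wstart d (n + j) = wstart d n + (\<Sum>l<j. win d (n + l))"
  by (induction j) (auto simp: wstart_def)

text \<open>A geometric series bounds the real-valued sizes by \<open>2 ^ i / d\<close>; rounding is
  charged one step per window.\<close>

lemma wstart_phase_add_le:
  assumes d: "0 < d" "d < 1" and i: "1 \<le> i" and j: "j \<le> phase_len d i"
  shows "wstart d (phase_start d i + j) \<le> wstart d (phase_start d i) + 2 ^ i / d + j"
proof -
  have "(\<Sum>l<j. real (win d (phase_start d i + l))) \<le> (\<Sum>l<j. 2 ^ i * (1 - d) ^ l + 1)"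
    using assms by (intro sum_mono win_le) auto
  also have "\<dots> = 2 ^ i * (\<Sum>l<j. (1 - d) ^ l) + j"
    by (simp add: sum.distrib sum_distrib_left)
  also have "(\<Sum>l<j. (1 - d) ^ l) \<le> 1 / d"
    using d by (simp add: sum_gp_strict divide_right_mono)
  finally show ?thesis by (simp add: wstart_add)
qed

text \<open>Doubling pays for the past: the phases before \<open>i\<close> and phase
  \<open>i\<close> itself cost \<open>2 ^ i / d\<close> each, together
  \<open>2 ^ (i + 1) / d\<close>.\<close>

lemma wstart_phase_start_le:
  assumes d: "0 < d" "d < 1" and i: "1 \<le> i"
  shows "wstart d (phase_start d i) \<le> 2 ^ i / d + phase_start d i"
  using i
proof (induction i rule: nat_induct_at_least)
  case base
  then show ?case using d by (simp add: phase_start_def wstart_def)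
next
  case (Suc i)
  then show ?case
    using wstart_phase_add_le[OF d Suc.hyps order_refl] by (simp add: phase_start_Suc)
qed

lemma phase_start_Suc_le:
  assumes d: "0 < d" "d < 1"
  shows "phase_start d (Suc i) \<le> i * (i / d + 1)"
proof -
  have "real (phase_start d (Suc i)) = (\<Sum>m\<in>{1..<Suc i}. real (phase_len d m))"
    by (simp add: phase_start_def)
  also have "\<dots> \<le> (\<Sum>m\<in>{1..<Suc i}. i / d + 1)"
  proof (intro sum_mono)
    fix m assume "m \<in> {1..<Suc i}"
    then have "m / d \<le> i / d" using d by (intro divide_right_mono) auto
    then show "real (phase_len d m) \<le> i / d + 1" using phase_len_le[OF d, of m] by linarith
  qed
  finally show ?thesis by simp
qed

lemma wstart_le:
  assumes d: "0 < d" "d < 1" and i: "1 \<le> i" and j: "j \<le> phase_len d i"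
  shows "wstart d (phase_start d i + j) \<le> 2 * 2 ^ i / d + i * (i / d + 1)"
proof -
  have "real (wstart d (phase_start d i + j)) \<le> 2 * (2 ^ i / d) + real (phase_start d i + j)"
    using wstart_phase_add_le[OF assms] wstart_phase_start_le[OF d i] by simp
  also have "real (phase_start d i + j) \<le> real (phase_start d (Suc i))"
    using i j by (simp add: phase_start_Suc)
  also have "\<dots> \<le> i * (i / d + 1)" by (rule phase_start_Suc_le[OF d])
  finally show ?thesis by simp
qed

section \<open>From an empty active set to the deadline\<close>

lemma le_wstart:
  assumes "0 < d" "d < 1"
  shows "n \<le> wstart d n"
proof -
  have "(\<Sum>m<n. 1) \<le> (\<Sum>m<n. win d m)"
    using win_pos[OF assms] by (intro sum_mono) (simp add: Suc_le_eq)
  then show ?thesis by (simp add: wstart_def)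
qed

text \<open>If \<open>l\<close> is the first index at which \<open>v\<close> is inactive, then
  \<open>v\<close> was delivered in window \<open>l - 1\<close>, which ends by the start of window
  \<open>n\<close>.\<close>

lemma all_delivered_withinI:
  fixes T :: real
  assumes empty: "act d k f n = {}" and T: "wstart d n \<le> T"
    and f: "\<And>m v. m < n \<Longrightarrow> v < k \<Longrightarrow> f (m, v) < win d m"
  shows "all_delivered_within d k T f"
  unfolding all_delivered_within_def
proof (intro allI impI)
  fix v assume v: "v < k"
  define l where "l = (LEAST l. v \<notin> act d k f l)"
  have l: "v \<notin> act d k f l" "l \<le> n"
    unfolding l_def using empty LeastI[of "\<lambda>l. v \<notin> act d k f l" n] by (auto intro: Least_le)
  have "l \<noteq> 0" using l v by (cases l) auto
  then obtain m where m: "l = Suc m" using not0_implies_Suc by blast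
  have "v \<in> act d k f m" using not_less_Least[of m "\<lambda>l. v \<notin> act d k f l"] m l_def by auto
  moreover have "real (wstart d m + f (m, v) + 1) \<le> T"
  proof -
    \<comment> \<open>Slots are 0-based and steps 1-based, so even the last slot ends exactly at the
      start of the next window.\<close>
    have "wstart d m + f (m, v) + 1 \<le> wstart d (Suc m)"
      using f[of m v] v m l by (simp add: wstart_def)
    also have "\<dots> \<le> wstart d n" unfolding wstart_def using m l by (intro sum_mono2) auto
    finally show ?thesis using T by linarith
  qed
  ultimately show "\<exists>n. v \<in> act d k f n \<and> v \<notin> act d k f (Suc n) \<and>
      real (wstart d n + f (n, v) + 1) \<le> T"
    using l m by blast
qed

lemma set_choices:
  assumes "0 < d" "d < 1" "f \<in> set_pmf (choices d k N)" "m < N" "v < k"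
  shows "f (m, v) < win d m"
proof -
  have "f \<in> PiE_dflt ({..<N} \<times> {..<k}) 0 (\<lambda>x. set_pmf (case x of (n, v) \<Rightarrow> pmf_of_set {..<win d n}))"
    using assms(3) by (simp add: choices_def set_Pi_pmf comp_def)
  then have "f (m, v) \<in> set_pmf (pmf_of_set {..<win d m})"
    using assms(4,5) by (auto simp: PiE_dflt_def)
  then show ?thesis using win_pos[OF assms(1,2), of m] by (simp add: set_pmf_of_set lessThan_empty_iff)
qed

lemma prob_all_delivered_ge:
  fixes T :: real
  assumes d: "0 < d" "d < 1" and T: "wstart d n \<le> T"
  shows "prob_all_delivered d k T
     \<ge> 1 - measure_pmf.prob (remaining {..<k} (win d) n {..<k}) {S. S \<noteq> {}}"
proof -
  define N where "N = nat \<lceil>T\<rceil> + 1"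
  \<comment> \<open>Each window takes at least one step, so the first \<open>n\<close> windows lie
    within the horizon \<open>N\<close> of \<open>choices\<close>.\<close>
  have "real n \<le> T" using le_wstart[OF d, of n] T by linarith
  then have n: "n \<le> N" unfolding N_def by linarith
  let ?M = "choices d k N"
  have "1 - measure_pmf.prob (remaining {..<k} (win d) n {..<k}) {S. S \<noteq> {}}
    = measure_pmf.prob (remaining {..<k} (win d) n {..<k}) {{}}"
    by (subst measure_pmf.prob_compl[symmetric]) (auto intro!: arg_cong[where f="measure_pmf.prob _"])
  also have "\<dots> = measure_pmf.prob ?M {f. act d k f n = {}}"
    unfolding map_act_choices[OF n, symmetric] measure_map_pmf by (simp add: vimage_def)
  also have "\<dots> \<le> measure_pmf.prob ?M {f. all_delivered_within d k T f}"
  proof (rule measure_pmf.finite_measure_mono_AE)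
    \<comment> \<open>The implication holds only almost surely: off the support a slot may lie
      outside its window.\<close>
    show "AE f in ?M. f \<in> {f. act d k f n = {}} \<longrightarrow> f \<in> {f. all_delivered_within d k T f}"
    proof (rule AE_pmfI)
      fix f assume f: "f \<in> set_pmf ?M"
      show "f \<in> {f. act d k f n = {}} \<longrightarrow> f \<in> {f. all_delivered_within d k T f}"
        using all_delivered_withinI[of d k f n T] set_choices[OF d f] T n by auto
    qed
  qed simp
  finally show ?thesis by (simp add: prob_all_delivered_def N_def)
qed

section \<open>Asymptotics of one phase\<close>

lemma two_power_ge_exists:
  fixes k :: nat
  assumes "k \<ge> 1"
  shows "\<exists>i. k \<le> 2 ^ i \<and> 2 ^ i < 2 * k"
proof -
  define i where "i = (LEAST i. k \<le> (2::nat) ^ i)"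
  have k: "k \<le> 2 ^ i" unfolding i_def
    by (rule LeastI[of _ k]) (simp add: less_imp_le)
  moreover have "2 ^ i < 2 * k"
  proof (cases i)
    case 0
    then show ?thesis using assms by simp
  next
    case (Suc j)
    then have "\<not> k \<le> 2 ^ j" using not_less_Least[of j "\<lambda>i. k \<le> (2::nat) ^ i"] i_def by simp
    then show ?thesis using Suc by simp
  qed
  ultimately show ?thesis by blast
qed

lemma half_le_round:
  fixes x :: real
  assumes "1 \<le> x"
  shows "x / 2 \<le> nat (round x)"
proof -
  have "x - 1 / 2 \<le> real_of_int (round x)" using of_int_round_ge[of x] by simp
  moreover have "round x \<ge> 1" using round_mono[OF assms] by simp
  ultimately show ?thesis using assms by simp
qed

lemma nat_le_roundI:
  assumes "real m \<le> x"
  shows "m \<le> nat (round x)"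
  using round_mono[OF assms] by simp

text \<open>\<open>T\<close> is chosen so that the fast-decaying bound \<open>\<rho> ^ T * W\<close> is still at least
  \<open>W powr (3/4)\<close>, while \<open>(q / \<rho>) ^ T\<close> is already at least a constant times \<open>W powr \<theta>\<close>; then
  \<open>L \<ge> 2 / \<theta>\<close> further windows bring the expected number of active nodes down to order \<open>1 / W\<close>.\<close>

lemma prob_phase_failure_eventually_le:
  fixes d :: real
  assumes d: "0 < d" "d < 1 / exp 1"
  shows "\<exists>i0. \<forall>i\<ge>i0. \<exists>n\<le>phase_len d i. \<forall>k\<le>(2::nat) ^ i. \<forall>A\<subseteq>{..<k}.
    measure_pmf.prob (remaining {..<k} (\<lambda>j. win d (phase_start d i + j)) n A) {S. S \<noteq> {}}
      \<le> (2 ^ i) powr (- 1 / 4)"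
proof -
  define q where "q = 1 - d"
  \<comment> \<open>Half the gap, so that \<open>\<rho>\<close> is the midpoint between
    \<open>1 - 1 / exp 1\<close> and \<open>q\<close>.\<close>
  define \<epsilon> where "\<epsilon> = (1 / exp 1 - d) / 2"
  define \<rho> where "\<rho> = 1 - 1 / exp 1 + \<epsilon>"
  have e1: "1 / exp 1 < (1::real)" by simp
  have d1: "d < 1" using d e1 by linarith
  have \<epsilon>: "\<epsilon> > 0" using d by (simp add: \<epsilon>_def)
  have \<rho>0: "0 < \<rho>" unfolding \<rho>_def using \<epsilon> e1 by linarith
  have \<rho>q: "\<rho> < q" unfolding \<rho>_def q_def \<epsilon>_def using d by (simp add: field_simps)
  have q: "0 < q" "q < 1" using d d1 by (auto simp: q_def)
  define r where "r = - ln \<rho>"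
  define u where "u = - ln q"
  have \<rho>_exp: "\<rho> = exp (- r)" and q_exp: "q = exp (- u)" using \<rho>0 q by (auto simp: r_def u_def)
  have r: "0 < u" "u < r" using \<rho>q \<rho>0 q by (auto simp: r_def u_def)
  \<comment> \<open>For \<open>T\<close> near \<open>ln W / (4 * r)\<close>, the load factor
    \<open>(\<rho> / q) ^ T = exp (- (r - u) * T)\<close> is about
    \<open>W powr (- \<theta>)\<close>.\<close>
  define \<theta> where "\<theta> = (r - u) / (4 * r)"
  have \<theta>: "\<theta> > 0" using r by (simp add: \<theta>_def)
  define L where "L = nat \<lceil>2 / \<theta>\<rceil>"
  have L: "2 \<le> \<theta> * L"
  proof -
    have "2 / \<theta> \<le> real L" unfolding L_def by linarith
    then show ?thesis using \<theta> by (simp add: field_simps)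
  qed
  define T where "T i = nat \<lfloor>i * ln 2 / (4 * r)\<rfloor>" for i :: nat
  \<comment> \<open>Collects the constants of \<open>\<beta> ^ L\<close>: the prefactor
    \<open>2 / q ^ L\<close>, and \<open>exp (r - u)\<close> for the floor in \<open>T\<close>, each
    to the power \<open>L\<close>.\<close>
  define C where "C = (2 / q ^ L) ^ L * exp ((r - u) * L)"
  \<comment> \<open>With \<open>W = 2 ^ i\<close>, the Chebyshev errors are of order
    \<open>i * W powr (- 3 / 4)\<close> and the Markov error is \<open>C / W\<close>. The second
    condition below keeps all \<open>T i + L\<close> windows inside the phase.\<close>
  have "eventually (\<lambda>i::nat. (i * ln 2 / (4 * r)) * (2 / (\<epsilon>^2 * (2 ^ i) powr (3 / 4))) + C / 2 ^ i
           \<le> (2 ^ i) powr (- 1 / 4)) at_top"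
    using r \<epsilon> by real_asymp
  moreover have "eventually (\<lambda>i::nat. 1 \<le> (2 ^ i) powr (3 / 4) * q ^ L) at_top"
    using q by real_asymp
  moreover have "eventually (\<lambda>i::nat. 1 \<le> i) at_top" by (rule eventually_ge_at_top)
  ultimately have "eventually (\<lambda>i::nat. \<exists>n\<le>phase_len d i. \<forall>k\<le>(2::nat) ^ i. \<forall>A\<subseteq>{..<k}.
    measure_pmf.prob (remaining {..<k} (\<lambda>j. win d (phase_start d i + j)) n A) {S. S \<noteq> {}}
      \<le> (2 ^ i) powr (- 1 / 4)) at_top"
  proof eventually_elim
    case (elim i)
    define W :: real where "W = 2 ^ i"
    define s where "s = W powr (3 / 4)"
    \<comment> \<open>The load bound in the second stage: the factor 2 pays for rounding, and
      \<open>q ^ L\<close> for the shrinking of the last \<open>L\<close> windows.\<close>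
    define \<beta> where "\<beta> = 2 * (\<rho> / q) ^ T i / q ^ L"
    have W: "W > 0" by (simp add: W_def)
    have lnW: "ln W = i * ln 2" by (simp add: W_def ln_realpow)
    have T_le: "T i \<le> i * ln 2 / (4 * r)"
      using r by (simp add: T_def)
    have T_ge: "i * ln 2 / (4 * r) - 1 \<le> T i" unfolding T_def by linarith
    have rT: "W powr (- 1 / 4) \<le> \<rho> ^ T i"
    proof -
      have "r * T i \<le> ln W / 4" using T_le r by (simp add: lnW field_simps)
      then have "exp (- ln W / 4) \<le> exp (- (r * T i))" by simp
      also have "\<dots> = \<rho> ^ T i" by (simp add: \<rho>_exp flip: exp_of_nat2_mult)
      finally show ?thesis using W by (simp add: powr_def)
    qed
    have s: "0 < s" "s \<le> \<rho> ^ T i * W"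
    proof -
      have "s = W powr (- 1 / 4) * W" unfolding s_def
        using W powr_add[of W "-1/4" 1] by simp
      also have "\<dots> \<le> \<rho> ^ T i * W" using rT W by (intro mult_right_mono) auto
      finally show "s \<le> \<rho> ^ T i * W" .
    qed (use W in \<open>simp add: s_def\<close>)
    \<comment> \<open>Since \<open>q > \<rho>\<close>, the window size after \<open>T i\<close>
      windows is at least \<open>s\<close>; \<open>L\<close> more windows cost only the constant
      factor \<open>q ^ L\<close>.\<close>
    have big: "1 \<le> W * q ^ (T i + L)"
    proof -
      have "1 \<le> s * q ^ L" using elim by (simp add: s_def W_def)
      also have "\<dots> \<le> \<rho> ^ T i * W * q ^ L" using s q by (intro mult_right_mono) auto
      also have "\<dots> \<le> q ^ T i * W * q ^ L" using \<rho>0 \<rho>q W q by (intro mult_right_mono power_mono) auto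
      finally show ?thesis by (simp add: power_add mult_ac)
    qed
    have large: "W * q ^ (T i + L) \<le> W * q ^ j" if "j \<le> T i + L" for j
      using that q W by (intro mult_left_mono power_decreasing) auto
    have in_phase: "j < phase_len d i" if "j \<le> T i + L" for j
      unfolding less_phase_len_iff[OF d(1) d1] using order_trans[OF big large[OF that]]
      by (simp add: W_def q_def)
    have win_eq: "win d (phase_start d i + j) = nat (round (W * q ^ j))" if "j \<le> T i + L" for j
      using win_phase[OF d(1) d1 _ in_phase[OF that]] elim by (simp add: W_def q_def)
    have "measure_pmf.prob (remaining {..<k} (\<lambda>j. win d (phase_start d i + j)) (T i + L) A) {S. S \<noteq> {}}
      \<le> (2 ^ i) powr (- 1 / 4)" if k: "k \<le> (2::nat) ^ i" and A: "A \<subseteq> {..<k}" for k :: nat and A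
    proof -
      have "real k \<le> real (2 ^ i)" using k by (rule of_nat_mono)
      moreover have "card A \<le> k" using card_mono[OF _ A] by simp
      ultimately have AW: "card A \<le> W" by (simp add: W_def)
      have "measure_pmf.prob (remaining {..<k} (\<lambda>j. win d (phase_start d i + j)) (T i + L) A) {S. S \<noteq> {}}
        \<le> T i * (2 / (\<epsilon>^2 * s)) + \<beta> ^ L * W"
      proof (rule prob_remaining_nonempty_two_stage_le[OF _ A AW, where ?\<epsilon>=\<epsilon>, folded \<rho>_def])
        fix j m :: nat assume j: "j < T i" and m: "m \<le> \<rho> ^ j * W"
        have "\<rho> ^ j * W \<le> q ^ j * W" using \<rho>0 \<rho>q W by (intro mult_right_mono power_mono) auto
        then have "m \<le> W * q ^ j" using m by (simp add: mult.commute)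
        then show "m \<le> win d (phase_start d i + j)" using j by (subst win_eq) (auto intro: nat_le_roundI)
      next
        fix j assume j: "j < L"
        have "\<rho> ^ T i * W = \<beta> * (W * q ^ (T i + L) / 2)"
          using q by (simp add: \<beta>_def power_add power_divide)
        also have "\<dots> \<le> \<beta> * (W * q ^ (T i + j) / 2)"
          using large[of "T i + j"] j \<rho>0 q by (intro mult_left_mono) (auto simp: \<beta>_def)
        also have "\<dots> \<le> \<beta> * win d (phase_start d i + (T i + j))"
        proof (intro mult_left_mono)
          show "W * q ^ (T i + j) / 2 \<le> win d (phase_start d i + (T i + j))"
            using half_le_round[OF order_trans[OF big large[of "T i + j"]]] j by (simp add: win_eq)
        qed (use \<rho>0 q in \<open>simp add: \<beta>_def\<close>)
        finally show "\<rho> ^ T i * W \<le> \<beta> * win d (phase_start d i + (T i + j))" .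
      qed (use \<epsilon> s \<rho>q q \<rho>0 win_pos[OF d(1) d1] in \<open>auto simp: \<beta>_def\<close>)
      also have "\<beta> ^ L * W \<le> C / W"
      proof -
        have "(\<rho> / q) ^ T i = exp (- (r - u) * T i)"
          by (simp add: \<rho>_exp q_exp flip: exp_diff exp_of_nat2_mult)
        then have "((\<rho> / q) ^ T i) ^ L = exp (- (r - u) * T i * L)"
          by (simp flip: exp_of_nat2_mult)
        \<comment> \<open>The floor loses at most \<open>r - u\<close> in each of the
          \<open>L\<close> exponents, and \<open>\<theta> * L \<ge> 2\<close> supplies
          \<open>W\<close> to the power -2.\<close>
        also have "\<dots> \<le> exp ((r - u) * L - 2 * ln W)"
        proof -
          have "(r - u) * (i * ln 2 / (4 * r) - 1) \<le> (r - u) * T i"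
            using T_ge r by (intro mult_left_mono) auto
          then have "\<theta> * ln W - (r - u) \<le> (r - u) * T i"
            by (simp add: \<theta>_def lnW algebra_simps)
          then have "(\<theta> * ln W - (r - u)) * L \<le> (r - u) * T i * L"
            by (intro mult_right_mono) auto
          moreover have "2 * ln W \<le> \<theta> * L * ln W"
            using L lnW by (intro mult_right_mono) auto
          ultimately show ?thesis by (simp add: algebra_simps)
        qed
        also have "\<dots> = exp ((r - u) * L) / W^2"
          using W exp_of_nat_mult[of 2 "ln W"] by (simp add: exp_diff)
        finally have *: "((\<rho> / q) ^ T i) ^ L \<le> exp ((r - u) * L) / W^2" .
        have "\<beta> = 2 / q ^ L * (\<rho> / q) ^ T i" by (simp add: \<beta>_def)
        then have "\<beta> ^ L * W = (2 / q ^ L) ^ L * ((\<rho> / q) ^ T i) ^ L * W"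
          by (simp only: power_mult_distrib)
        also have "\<dots> \<le> (2 / q ^ L) ^ L * (exp ((r - u) * L) / W^2) * W"
          using * W q by (intro mult_right_mono mult_left_mono) auto
        also have "\<dots> = C / W" using W by (simp add: C_def power2_eq_square)
        finally show ?thesis .
      qed
      also have "T i * (2 / (\<epsilon>^2 * s)) \<le> i * ln 2 / (4 * r) * (2 / (\<epsilon>^2 * s))"
        using T_le s by (intro mult_right_mono) auto
      finally show ?thesis using elim by (simp add: s_def W_def)
    qed
    moreover have "T i + L \<le> phase_len d i" using in_phase[of "T i + L"] by simp
    ultimately show ?case by (intro exI[of _ "T i + L"]) simp
  qed
  then show ?thesis by (simp add: eventually_at_top_linorder)
qed

theorem mainTheorem3:
  fixes \<delta> :: real
  assumes "0 < \<delta>" and "\<delta> < 1 / exp 1"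
  shows "\<exists>c > 0. \<exists>k0::nat. \<forall>k \<ge> k0.
           prob_all_delivered \<delta> k (4 * (1 + 1 / \<delta>) * real k) \<ge> 1 - 1 / real k powr c"
proof -
  let ?c = "1 / 4 :: real"
  have "1 / exp 1 < (1::real)" by simp
  then have d: "0 < \<delta>" "\<delta> < 1" using assms by linarith+
  obtain i1 where i1: "\<And>i. i \<ge> i1 \<Longrightarrow> \<exists>n\<le>phase_len \<delta> i. \<forall>k\<le>(2::nat) ^ i. \<forall>A\<subseteq>{..<k}.
    measure_pmf.prob (remaining {..<k} (\<lambda>j. win \<delta> (phase_start \<delta> i + j)) n A) {S. S \<noteq> {}}
      \<le> (2 ^ i) powr (- 1 / 4)"
    using prob_phase_failure_eventually_le[OF assms] by blast
  \<comment> \<open>The rounding overhead is eventually at most \<open>2 * 2 ^ i\<close>, hence at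
    most \<open>4 * k\<close>: this is the summand 1 in
    \<open>4 * (1 + 1 / \<delta>)\<close>.\<close>
  have "eventually (\<lambda>i::nat. i * (i / \<delta> + 1) \<le> 2 * 2 ^ i) at_top"
    using d by real_asymp
  then obtain i2 where i2: "\<And>i::nat. i \<ge> i2 \<Longrightarrow> i * (i / \<delta> + 1) \<le> 2 * 2 ^ i"
    by (auto simp: eventually_at_top_linorder)
  define i0 where "i0 = max 1 (max i1 i2)"
  have "prob_all_delivered \<delta> k (4 * (1 + 1 / \<delta>) * real k) \<ge> 1 - 1 / real k powr ?c"
    if k: "k \<ge> 2 ^ i0" for k
  proof -
    have "(1::nat) \<le> 2 ^ i0" by simp
    then have k1: "k \<ge> 1" using k by (rule order_trans)
    then obtain i where i: "k \<le> 2 ^ i" "2 ^ i < 2 * k" using two_power_ge_exists by blast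
    have "(2::nat) ^ i0 \<le> 2 ^ i" using i k by linarith
    then have "i0 \<le> i" by simp
    then have ii: "1 \<le> i" "i1 \<le> i" "i2 \<le> i" by (auto simp: i0_def)
    have iW: "real k \<le> 2 ^ i" "2 ^ i \<le> 2 * real k"
      using of_nat_mono[OF i(1), where 'a=real] of_nat_mono[OF less_imp_le[OF i(2)], where 'a=real]
      by simp_all
    obtain n where n: "n \<le> phase_len \<delta> i" and fail: "\<And>A. A \<subseteq> {..<k} \<Longrightarrow>
      measure_pmf.prob (remaining {..<k} (\<lambda>j. win \<delta> (phase_start \<delta> i + j)) n A) {S. S \<noteq> {}}
        \<le> (2 ^ i) powr (- 1 / 4)"
      using i1[OF ii(2)] i(1) by (elim exE conjE) simp
    have "wstart \<delta> (phase_start \<delta> i + n) \<le> 2 * 2 ^ i / \<delta> + i * (i / \<delta> + 1)"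
      by (rule wstart_le[OF d ii(1) n])
    also have "\<dots> \<le> 2 * (2 * real k) / \<delta> + 2 * (2 * real k)"
      using i2[OF ii(3)] iW d by (intro add_mono divide_right_mono) auto
    also have "\<dots> = 4 * (1 + 1 / \<delta>) * real k" using d by (simp add: field_simps)
    finally have "1 - measure_pmf.prob (remaining {..<k} (win \<delta>) (phase_start \<delta> i + n) {..<k}) {S. S \<noteq> {}}
       \<le> prob_all_delivered \<delta> k (4 * (1 + 1 / \<delta>) * real k)"
      by (rule prob_all_delivered_ge[OF d])
    \<comment> \<open>The bound for phase \<open>i\<close> holds whatever set is active at its
      start, so the exceptional set is empty and earlier phases contribute no error.\<close>
    moreover have "measure_pmf.prob (remaining {..<k} (win \<delta>) (phase_start \<delta> i + n) {..<k}) {S. S \<noteq> {}}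
       \<le> measure_pmf.prob (remaining {..<k} (win \<delta>) (phase_start \<delta> i) {..<k}) {} + (2 ^ i) powr (- 1 / 4)"
      unfolding remaining_add
      by (rule prob_bind_pmf_le, rule fail, erule set_remaining) simp
    moreover have "(2 ^ i) powr (- 1 / 4) \<le> real k powr (- 1 / 4)"
      using iW k1 by (intro powr_mono2') auto
    moreover have "real k powr (- 1 / 4) = 1 / real k powr ?c"
      by (simp add: powr_minus_divide[of "real k" "1/4", simplified])
    ultimately show ?thesis by simp
  qed
  then show ?thesis by (intro exI[of _ ?c] conjI exI[of _ "2 ^ i0"]) auto
qed

end
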